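(* Let $p\in\mathcal{A}\cap\mathcal{N}$ with $1<p^-\le p^+<\infty$. Then there exist constants $c>0$ and $\epsilon>0$, depending only on $n,p^-,p^+,[p]_{\mathcal A},[p]_{\mathcal N}$, such that for all cubes $Q\subset\mathbb{R}^n$ with $|Q|\le1$ and all $f$ with $\|f\|_{L^{p(\cdot)}+L^\infty}\le1$, $$\frac1{|Q|}\int_Q\left(\frac1{|Q|}\int_Q|f(y)|\,dy\right)^{p(x)}dx\le c\,\frac1{|Q|}\int_Q|f(x)|^{p(x)}\,dx+|Q|^{\epsilon}.$$
   Context: A variable exponent is a measurable function $p:\mathbb{R}^n\to[1,\infty]$; $p^-,p^+\in[1,\infty]$ are bounds with $p^-\le p(x)\le p^+$ for all $x\in\mathbb{R}^n$. The conjugate exponent $p'$ is defined pointwise by $\frac1{p(x)}+\frac1{p'(x)}=1$ (with $1/\infty=0$). For a measurable exponent $q$ on $\mathbb{R}^n$ the norm is $\|f\|_{q(\cdot)}=\inf\{\lambda>0:\int_{\mathbb{R}^n}|f(x)/\lambda|^{q(x)}\,dx\le1\}$, with the convention $t^\infty=0$ for $t\in[0,1]$ and $t^\infty=\infty$ for $t>1$; $L^{q(\cdot)}(\mathbb{R}^n)$ is the set of $f\in L^1_{\mathrm{loc}}(\mathbb{R}^n)$ with finite norm. Class $\mathcal{A}$: $p\in\mathcal{A}$ iff $[p]_{\mathcal A}:=\sup_Q\frac{\|\mathbf 1_Q\|_{p(\cdot)}\|\mathbf 1_Q\|_{p'(\cdot)}}{|Q|}<\infty$, the supremum over all cubes $Q\subset\mathbb{R}^n$.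 Class $\mathcal{N}$ (Nekvinda condition): $p\in\mathcal N$ iff for some $p_\infty\in[p^-,p^+]$, with $\frac1{r(x)}:=\left|\frac1{p(x)}-\frac1{p_\infty}\right|$, one has $1\in L^{r(\cdot)}(\mathbb{R}^n)$; $[p]_{\mathcal N}:=\|1\|_{r(\cdot)}$. Sum space: $\|f\|_{L^{p(\cdot)}+L^\infty}=\inf\{\|g\|_{p(\cdot)}+\|h\|_\infty: f=g+h,\ g\in L^{p(\cdot)}(\mathbb{R}^n),\ h\in L^\infty(\mathbb{R}^n)\}$. *)

theory Defs
  imports "HOL-Analysis.Analysis" "HOL-Probability.Essential_Supremum"
begin

text \<open>
  Exponents take values in \<^typ>\<open>ereal\<close>, where \<open>1 / \<infinity> = 0\<close> and \<open>1 / 0 = \<infinity>\<close>. Norms, modulars and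
  averages take values in \<^typ>\<open>ennreal\<close>, so that no integrability is presupposed and a space is
  the set of (suitably measurable) functions of finite norm. Measurability and integration are
  with respect to the completed Lebesgue measure.
\<close>

definition variable_exponent :: "(real ^ 'n \<Rightarrow> ereal) \<Rightarrow> bool" where
  "variable_exponent p \<longleftrightarrow> p \<in> borel_measurable lebesgue \<and> (\<forall>x. 1 \<le> p x)"

definition exponent_bounds :: "ereal \<Rightarrow> ereal \<Rightarrow> (real ^ 'n \<Rightarrow> ereal) \<Rightarrow> bool" where
  "exponent_bounds pm pp p \<longleftrightarrow> (\<forall>x. pm \<le> p x \<and> p x \<le> pp)"

definition conj_exponent :: "(real ^ 'n \<Rightarrow> ereal) \<Rightarrow> real ^ 'n \<Rightarrow> ereal" where
  "conj_exponent p x = 1 / (1 - 1 / p x)"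

lemma conj_exponent_eq:
  assumes "1 \<le> p x"
  shows "1 / p x + 1 / conj_exponent p x = 1"
proof (cases "p x")
  case (real r)
  with assms have r: "r \<ge> 1" by simp
  show ?thesis
  proof (cases "r = 1")
    case True
    then show ?thesis
      using real by (simp add: conj_exponent_def divide_ereal_def one_ereal_def)
  next
    case False
    then show ?thesis
      using real r by (simp add: conj_exponent_def divide_ereal_def one_ereal_def field_simps)
  qed
next
  case PInf
  then show ?thesis by (simp add: conj_exponent_def divide_ereal_def one_ereal_def)
next
  case MInf
  then show ?thesis using assms by simp
qed

text \<open>The power \<open>t\<^sup>q\<close> for \<open>t \<in> [0,\<infinity>]\<close> and \<open>q \<in> [1,\<infinity>]\<close>, where \<open>t\<^sup>\<infinity>\<close> is \<open>0\<close> on \<open>[0,1]\<close> and \<open>\<infinity>\<close> above.\<close>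

definition epower :: "ennreal \<Rightarrow> ereal \<Rightarrow> ennreal" where
  "epower t q =
    (if q = \<infinity> then (if t \<le> 1 then 0 else \<infinity>)
     else if t = \<infinity> then \<infinity>
     else ennreal (enn2real t powr real_of_ereal q))"

definition modular :: "(real ^ 'n \<Rightarrow> ereal) \<Rightarrow> (real ^ 'n \<Rightarrow> real) \<Rightarrow> ennreal" where
  "modular q f = (\<integral>\<^sup>+ x. epower (ennreal \<bar>f x\<bar>) (q x) \<partial>lebesgue)"

definition var_norm :: "(real ^ 'n \<Rightarrow> ereal) \<Rightarrow> (real ^ 'n \<Rightarrow> real) \<Rightarrow> ennreal" where
  "var_norm q f = Inf {ennreal l | l. l > 0 \<and> modular q (\<lambda>x. f x / l) \<le> 1}"

definition locally_L1 :: "(real ^ 'n \<Rightarrow> real) set" where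
  "locally_L1 = {f. \<forall>K. compact K \<longrightarrow> f absolutely_integrable_on K}"

definition var_Lspace :: "(real ^ 'n \<Rightarrow> ereal) \<Rightarrow> (real ^ 'n \<Rightarrow> real) set" where
  "var_Lspace q = {f \<in> locally_L1. var_norm q f < \<infinity>}"

definition Linf_norm :: "(real ^ 'n \<Rightarrow> real) \<Rightarrow> ennreal" where
  "Linf_norm f = esssup lebesgue (\<lambda>x. ennreal \<bar>f x\<bar>)"

definition Linf_space :: "(real ^ 'n \<Rightarrow> real) set" where
  "Linf_space = {f \<in> borel_measurable lebesgue. Linf_norm f < \<infinity>}"

text \<open>The infimum over the empty set is \<open>\<infinity>\<close>, so a finite value entails membership in the sum space.\<close>

definition sum_norm :: "(real ^ 'n \<Rightarrow> ereal) \<Rightarrow> (real ^ 'n \<Rightarrow> real) \<Rightarrow> ennreal" where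
  "sum_norm p f =
    Inf {var_norm p g + Linf_norm h | g h.
      g \<in> var_Lspace p \<and> h \<in> Linf_space \<and> (\<forall>x. f x = g x + h x)}"

text \<open>Cubes are non-degenerate with sides parallel to the axes.\<close>

definition cubes :: "(real ^ 'n) set set" where
  "cubes = {cbox a (\<chi> i. a $ i + l) | a l. l > 0}"

definition A_const :: "(real ^ 'n \<Rightarrow> ereal) \<Rightarrow> ennreal" where
  "A_const p =
    (SUP Q\<in>cubes. var_norm p (indicator Q) * var_norm (conj_exponent p) (indicator Q)
                    / emeasure lebesgue Q)"

definition class_A :: "(real ^ 'n \<Rightarrow> ereal) set" where
  "class_A = {p. variable_exponent p \<and> A_const p < \<infinity>}"

definition nekvinda_exponent :: "(real ^ 'n \<Rightarrow> ereal) \<Rightarrow> ereal \<Rightarrow> real ^ 'n \<Rightarrow> ereal" where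
  "nekvinda_exponent p p_inf x = 1 / \<bar>1 / p x - 1 / p_inf\<bar>"

definition N_const :: "(real ^ 'n \<Rightarrow> ereal) \<Rightarrow> ereal \<Rightarrow> ennreal" where
  "N_const p p_inf = var_norm (nekvinda_exponent p p_inf) (\<lambda>_. 1)"

text \<open>The constant \<^const>\<open>N_const\<close> depends on the limit exponent, hence admissibility of a given one
  is separated from membership in the class.\<close>

definition nekvinda_limit :: "ereal \<Rightarrow> ereal \<Rightarrow> (real ^ 'n \<Rightarrow> ereal) \<Rightarrow> ereal \<Rightarrow> bool" where
  "nekvinda_limit pm pp p p_inf \<longleftrightarrow>
     pm \<le> p_inf \<and> p_inf \<le> pp \<and> (\<lambda>_. 1) \<in> var_Lspace (nekvinda_exponent p p_inf)"

definition class_N :: "ereal \<Rightarrow> ereal \<Rightarrow> (real ^ 'n \<Rightarrow> ereal) set" where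
  "class_N pm pp = {p. variable_exponent p \<and> (\<exists>p_inf. nekvinda_limit pm pp p p_inf)}"

end

theory Submission
  imports Defs "HOL-Probability.Probability_Measure"
begin

text \<open>
  Fix a cube \<open>Q\<close> with \<open>\<bar>Q\<bar> = exp (- L)\<close>, \<open>L \<ge> 0\<close>, average over it, and let \<open>s\<close> be the mean of
  \<open>1 / p\<close> on \<open>Q\<close>, \<open>r = 1 / s\<close> the harmonic mean of \<open>p\<close>, and \<open>q\<close> the conjugate exponent.

  \<^emph>\<open>What the class says about one cube.\<close> One always has \<open>\<parallel>1\<^sub>Q\<parallel>\<^sub>p \<ge> \<bar>Q\<bar> powr s\<close> (a consequence of
  \<open>exp y \<ge> 1 + y\<close> and of the inequality between harmonic and arithmetic mean), and likewise
  \<open>\<parallel>1\<^sub>Q\<parallel>\<^sub>q \<ge> \<bar>Q\<bar> powr (1 - s)\<close>. These lower bounds multiply to \<open>\<bar>Q\<bar>\<close>, so a bound \<open>K \<bar>Q\<bar>\<close> for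
  the product of the two norms makes each of the lower bounds sharp up to the factor \<open>K\<close>. Written
  out as modulars, this says that the averages of \<open>exp (L * (p * s - 1))\<close> and of
  \<open>exp (L * (q * (1 - s) - 1))\<close> are bounded: an exponential integrability of the oscillation of
  \<open>p\<close>, in which the first quantity controls the part where \<open>p > r\<close> and the second the part
  where \<open>p < r\<close>.

  \<^emph>\<open>From the critical level to other levels.\<close> For \<open>m\<close> between \<open>\<bar>Q\<bar> powr \<delta>\<close> and a multiple of
  \<open>\<bar>Q\<bar> powr (- s)\<close>, where \<open>\<delta>\<close> is small, the functions \<open>m powr (p - r)\<close> and
  \<open>m powr ((r - p) / (p - 1))\<close> are dominated pointwise by those two exponentials
  (\<open>exp_oscillation_pointwise\<close>), and their averages are bounded by a constant \<open>C\<close>.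

  \<^emph>\<open>Duality.\<close> Let \<open>m\<close> be the average of \<open>\<bar>f\<bar>\<close>, and let \<open>v\<close> be the average of
  \<open>m powr (p - 1)\<close>, so that \<open>m * v\<close> is the average of \<open>m powr p\<close>. Young's inequality with the
  constant test function \<open>\<kappa> * v\<close> gives
  \<open>\<kappa> * v * m \<le> avg (\<bar>f\<bar> powr p) + avg ((\<kappa> * v) powr q)\<close>. The bounds just described make the last
  term at most half of the left-hand side once \<open>\<kappa>\<close> is small, which leaves
  \<open>avg (m powr p) \<le> (2 / \<kappa>) * avg (\<bar>f\<bar> powr p)\<close> (\<open>modular_Jensen\<close>).

  \<^emph>\<open>The range of levels.\<close> The norm of \<open>f\<close> enters only through the upper bound for \<open>m\<close>: the
  \<open>L\<^sup>p\<close> part of \<open>f\<close> has average at most a multiple of \<open>\<bar>Q\<bar> powr (- s)\<close> by the same duality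
  argument at the critical level, and the bounded part is harmless since \<open>\<bar>Q\<bar> \<le> 1\<close>. If
  \<open>m < \<bar>Q\<bar> powr \<delta>\<close>, then \<open>m powr p \<le> m < \<bar>Q\<bar> powr \<delta>\<close>; this is the additive error term.
\<close>

section \<open>Bounded exponents on a probability space\<close>

locale bounded_exponent = prob_space +
  fixes p :: "'a \<Rightarrow> real" and a b :: real
  assumes measurable_p [measurable]: "p \<in> borel_measurable M"
    and one_less_a: "1 < a" and p_lower: "\<And>x. a \<le> p x" and p_upper: "\<And>x. p x \<le> b"
begin

definition "mean_recip = (\<integral>x. 1 / p x \<partial>M)"

definition "p_conj x = p x / (p x - 1)"

lemma p_gt_1: "1 < p x"
  using one_less_a p_lower[of x] by simp

lemma a_le_b: "a \<le> b"
  using p_lower[of undefined] p_upper[of undefined] by simp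

lemma integrable_bounded:
  fixes g :: "'a \<Rightarrow> real"
  assumes [measurable]: "g \<in> borel_measurable M" and "\<And>x. \<bar>g x\<bar> \<le> c"
  shows "integrable M g"
  using assms by (intro integrable_const_bound[where B = c]) auto

lemma integrable_exp:
  fixes g :: "'a \<Rightarrow> real"
  assumes [measurable]: "g \<in> borel_measurable M" and "\<And>x. \<bar>g x\<bar> \<le> c"
  shows "integrable M (\<lambda>x. exp (g x))"
proof (rule integrable_bounded)
  show "\<bar>exp (g x)\<bar> \<le> exp c" for x
    using assms(2)[of x] by simp
qed simp

lemma p_abs_le: "\<bar>p x\<bar> \<le> b"
  using p_gt_1[of x] p_upper[of x] by simp

lemma integrable_p: "integrable M p"
  by (rule integrable_bounded[OF _ p_abs_le]) simp

lemma integrable_recip: "integrable M (\<lambda>x. 1 / p x)"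
  by (rule integrable_bounded[where c = 1]) (use p_gt_1 in \<open>auto intro: less_imp_le simp: abs_of_pos order_less_trans[OF zero_less_one p_gt_1]\<close>)

lemma mean_recip_lower: "1 / b \<le> mean_recip"
proof -
  have "(\<integral>x. 1 / b \<partial>M) \<le> mean_recip"
    unfolding mean_recip_def
    by (intro integral_mono integrable_recip)
       (use p_gt_1 p_upper order_less_trans[OF zero_less_one p_gt_1] in \<open>auto intro!: frac_le\<close>)
  then show ?thesis by (simp add: prob_space)
qed

lemma mean_recip_upper: "mean_recip \<le> 1 / a"
proof -
  have "mean_recip \<le> (\<integral>x. 1 / a \<partial>M)"
    unfolding mean_recip_def
    by (intro integral_mono integrable_recip)
       (use one_less_a p_lower in \<open>auto intro!: frac_le\<close>)
  then show ?thesis by (simp add: prob_space)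
qed

lemma mean_recip_bounds: "0 < mean_recip" "mean_recip < 1"
proof -
  have "0 < 1 / b" "1 / a < 1" using one_less_a a_le_b by auto
  then show "0 < mean_recip" "mean_recip < 1"
    using mean_recip_lower mean_recip_upper by linarith+
qed

lemma conj_exponent_bounded: "bounded_exponent M p_conj (b / (b - 1)) (a / (a - 1))"
proof
  show "p_conj \<in> borel_measurable M" unfolding p_conj_def by simp
  show "1 < b / (b - 1)" using one_less_a a_le_b by simp
  fix x
  show "b / (b - 1) \<le> p_conj x" "p_conj x \<le> a / (a - 1)"
    using p_gt_1[of x] one_less_a p_upper[of x] p_lower[of x] a_le_b
    by (auto simp: p_conj_def field_simps)
qed

lemma conj_abs_le: "\<bar>p_conj x\<bar> \<le> a / (a - 1)"
  by (rule bounded_exponent.p_abs_le[OF conj_exponent_bounded])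

lemma measurable_conj [measurable]: "p_conj \<in> borel_measurable M"
  unfolding p_conj_def by simp

lemma young: "0 \<le> u \<Longrightarrow> 0 \<le> v \<Longrightarrow> u * v \<le> u powr p x + v powr p_conj x"
proof -
  assume uv: "0 \<le> u" "0 \<le> v"
  have p: "1 < p x" by (rule p_gt_1)
  then have q: "1 < p_conj x" by (simp add: p_conj_def)
  have "u * v \<le> u powr p x / p x + v powr p_conj x / p_conj x"
    using p q uv by (intro Youngs_inequality) (auto simp: p_conj_def field_simps)
  also have "\<dots> \<le> u powr p x / 1 + v powr p_conj x / 1"
    using p q by (intro add_mono divide_left_mono) auto
  finally show ?thesis by simp
qed

lemma mean_recip_conj: "bounded_exponent.mean_recip M p_conj = 1 - mean_recip"
proof -
  have "(\<integral>x. 1 / p_conj x \<partial>M) = (\<integral>x. 1 - 1 / p x \<partial>M)"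
  proof (intro Bochner_Integration.integral_cong refl)
    show "1 / p_conj x = 1 - 1 / p x" for x
      using p_gt_1[of x] by (simp add: p_conj_def field_simps)
  qed
  also have "\<dots> = 1 - mean_recip"
    unfolding mean_recip_def using integrable_recip by (simp add: prob_space)
  finally show ?thesis
    by (simp add: bounded_exponent.mean_recip_def[OF conj_exponent_bounded])
qed

text \<open>
  The integrand \<open>p\<close> is convex as a function \<open>1 / \<sigma>\<close> of \<open>\<sigma> = 1 / p\<close>, and \<open>2 * r - r\<^sup>2 * \<sigma>\<close> is its
  tangent line at \<open>\<sigma> = 1 / r\<close>.
\<close>

lemma harmonic_le_arithmetic: "1 / mean_recip \<le> (\<integral>x. p x \<partial>M)"
proof -
  define r where "r = 1 / mean_recip"
  have r: "0 < r" using mean_recip_bounds by (simp add: r_def)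
  have "(\<integral>x. 2 * r - r\<^sup>2 * (1 / p x) \<partial>M) \<le> (\<integral>x. p x \<partial>M)"
  proof (intro integral_mono integrable_p)
    show "integrable M (\<lambda>x. 2 * r - r\<^sup>2 * (1 / p x))"
      using integrable_recip by (intro Bochner_Integration.integrable_diff integrable_mult_right) auto
    fix x
    have "0 \<le> (p x - r)\<^sup>2 / p x" using p_gt_1[of x] by simp
    also have "\<dots> = p x - (2 * r - r\<^sup>2 * (1 / p x))"
      using p_gt_1[of x] by (simp add: power2_eq_square field_simps)
    finally show "2 * r - r\<^sup>2 * (1 / p x) \<le> p x" by simp
  qed
  also have "(\<integral>x. 2 * r - r\<^sup>2 * (1 / p x) \<partial>M) = 2 * r - r\<^sup>2 * mean_recip"
    unfolding mean_recip_def
    using integrable_mult_right[OF integrable_recip, of "r\<^sup>2"]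
    by (subst Bochner_Integration.integral_diff) (simp_all only: integral_mult_right_zero, simp_all add: prob_space)
  also have "\<dots> = r"
    using mean_recip_bounds by (simp add: r_def power2_eq_square field_simps)
  finally show ?thesis by (simp add: r_def)
qed

text \<open>
  The hypothesis says that \<open>exp (- y)\<close> is an admissible scaling of the indicator of a set of
  measure \<open>exp (- L)\<close>; the conclusion is the sharp lower bound for such scalings. The estimate
  \<open>exp u \<ge> 1 + u\<close> turns the hypothesis into a bound for \<open>y\<close> times the arithmetic mean of \<open>p\<close>.
\<close>

lemma mean_recip_critical:
  assumes "0 \<le> L" and "(\<integral>x. exp (y * p x - L) \<partial>M) \<le> 1"
  shows "y \<le> L * mean_recip"
proof (cases "0 \<le> y")
  case True
  have "(\<integral>x. 1 + (y * p x - L) \<partial>M) \<le> (\<integral>x. exp (y * p x - L) \<partial>M)"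
  proof (intro integral_mono exp_ge_add_one_self)
    show "integrable M (\<lambda>x. 1 + (y * p x - L))"
      using integrable_p by simp
    have "\<bar>y * p x - L\<bar> \<le> \<bar>y\<bar> * b + L" for x
      using mult_left_mono[OF p_abs_le, of "\<bar>y\<bar>" x] \<open>0 \<le> L\<close>
        abs_triangle_ineq4[of "y * p x" L] by (simp add: abs_mult)
    then show "integrable M (\<lambda>x. exp (y * p x - L))"
      by (intro integrable_exp) auto
  qed
  also have "(\<integral>x. 1 + (y * p x - L) \<partial>M) = 1 + (y * (\<integral>x. p x \<partial>M) - L)"
    using integrable_p by (simp add: prob_space)
  finally have "y * (\<integral>x. p x \<partial>M) \<le> L" using assms by simp
  moreover have "y * (1 / mean_recip) \<le> y * (\<integral>x. p x \<partial>M)"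
    using True harmonic_le_arithmetic by (rule mult_left_mono[rotated])
  ultimately have "y / mean_recip \<le> L" by simp
  then show ?thesis using mean_recip_bounds by (simp add: field_simps)
next
  case False
  then have "y \<le> 0" by simp
  also have "0 \<le> L * mean_recip" using mean_recip_bounds assms by simp
  finally show ?thesis .
qed

end

section \<open>Exponential oscillation and a modular Jensen inequality\<close>

text \<open>
  With \<open>z = p / r - 1\<close> and \<open>w\<close> its conjugate counterpart one has \<open>w = - z / (p - 1)\<close>, so \<open>z\<close> and
  \<open>w\<close> have opposite signs, and the two exponents are \<open>t * (r * z)\<close> and \<open>t * (r * w)\<close>. For
  \<open>t \<ge> 0\<close> each of them, unless it is negative, is compared with its own critical exponential; for
  \<open>t < 0\<close> it is compared with the other one, and there \<open>\<delta>\<close> has to be so small that the factors lost when \<open>z\<close> and \<open>w\<close>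
  are exchanged are absorbed.
\<close>

lemma exp_oscillation_pointwise:
  fixes a b p r L d t \<delta> :: real
  assumes a: "1 < a" and p: "a \<le> p" "p \<le> b" and r: "a \<le> r" "r \<le> b"
    and L: "0 \<le> L" and d: "0 \<le> d"
    and \<delta>: "0 \<le> \<delta>" "\<delta> * (b * (b - 1)) \<le> 1" "\<delta> * b \<le> a - 1"
    and t: "- (\<delta> * L) \<le> t" "t \<le> L / r + d"
  defines "bound \<equiv> 1 + exp (d * (b * (a / (a - 1)))) *
             (exp (L * (p / r - 1)) + exp (L * (p / (p - 1) * (1 - 1 / r) - 1)))"
  shows "exp (t * (p - r)) \<le> bound" and "exp (t * ((r - p) / (p - 1))) \<le> bound"
proof -
  define z where "z = p / r - 1"
  define w where "w = p / (p - 1) * (1 - 1 / r) - 1"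
  define e where "e = b * (a / (a - 1))"
  have pos: "0 < r" "0 < b" "0 < p - 1" "0 < a - 1" "0 < b - 1" using assms by auto
  have zr: "p - r = r * z" using pos by (simp add: z_def field_simps)
  have wz: "w = - z / (p - 1)" using pos by (simp add: z_def w_def field_simps)
  have wr: "(r - p) / (p - 1) = r * w"
    using zr by (simp add: wz field_simps)
  have e1: "1 \<le> a / (a - 1)" using a by (simp add: field_simps)
  have be: "b \<le> e" using mult_left_mono[OF e1, of b] pos by (simp add: e_def)
  have e0: "0 \<le> e" using be pos by simp
  have zw: "w = 0 \<and> z = 0 \<or> 0 < z \<and> w < 0 \<or> z < 0 \<and> 0 < w"
    using pos unfolding wz by (auto simp: field_simps)
  have pos_t: "t * (r * y) \<le> L * y + d * e" if "0 \<le> y" "r * y \<le> e" for y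
  proof -
    have "t * (r * y) \<le> (L / r + d) * (r * y)"
      using that t pos by (intro mult_right_mono) auto
    also have "\<dots> = L * y + d * (r * y)" using pos by (simp add: field_simps)
    also have "\<dots> \<le> L * y + d * e" using that d by (intro add_left_mono mult_left_mono)
    finally show ?thesis .
  qed
  have rz: "r * z \<le> e" using zr be p r pos by linarith
  have rw: "r * w \<le> e"
  proof -
    have "(r - p) / (p - 1) \<le> b / (a - 1)"
      using r p a pos by (intro frac_le) auto
    also have "\<dots> \<le> b * a / (a - 1)"
      using pos a by (intro divide_right_mono) auto
    finally show ?thesis by (simp add: wr e_def)
  qed
  have neg1: "t * (r * z) \<le> L * w" if "t \<le> 0" "z \<le> 0"
  proof -
    have w0: "0 \<le> w" using zw that by auto
    have "t * (r * z) = (- t) * (r * ((p - 1) * w))" using pos by (simp add: wz)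
    also have "\<dots> \<le> (\<delta> * L) * (b * ((b - 1) * w))"
      using that t pos p r w0 \<delta> L by (intro mult_mono mult_right_mono mult_nonneg_nonneg) auto
    also have "\<dots> = (\<delta> * (b * (b - 1))) * (L * w)" by simp
    also have "\<dots> \<le> 1 * (L * w)" using \<delta> L w0 by (intro mult_right_mono) auto
    finally show ?thesis by simp
  qed
  have neg2: "t * (r * w) \<le> L * z" if "t \<le> 0" "w \<le> 0"
  proof -
    have z0: "0 \<le> z" using zw that by auto
    have "t * (r * w) = (- t) * (r * (z / (p - 1)))" using pos by (simp add: wz)
    also have "\<dots> \<le> (\<delta> * L) * (b * (z / (a - 1)))"
      using that t pos p r z0 \<delta> L by (intro mult_mono mult_nonneg_nonneg frac_le) auto
    also have "\<dots> = (\<delta> * b) / (a - 1) * (L * z)" by simp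
    also have "\<dots> \<le> 1 * (L * z)" using \<delta> L z0 pos by (intro mult_right_mono) auto
    finally show ?thesis by simp
  qed
  have fin: "exp y \<le> bound" if "y \<le> 0 \<or> y \<le> L * z + d * e \<or> y \<le> L * w + d * e" for y
  proof -
    have B: "bound = 1 + exp (d * e + L * z) + exp (d * e + L * w)"
      by (simp add: bound_def z_def w_def e_def exp_add distrib_left)
    have *: "exp y \<le> 1 \<or> exp y \<le> exp (d * e + L * z) \<or> exp y \<le> exp (d * e + L * w)"
      using that by (auto simp: add.commute)
    show ?thesis
      unfolding B using * exp_gt_zero[of "d * e + L * z"] exp_gt_zero[of "d * e + L * w"] by linarith
  qed
  have sgn: "t * (r * y) \<le> 0" if "0 \<le> t \<and> y \<le> 0 \<or> t \<le> 0 \<and> 0 \<le> y" for y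
    using that pos by (auto simp: mult_le_0_iff)
  have de: "0 \<le> d * e" using d e0 by simp
  show "exp (t * (p - r)) \<le> bound"
    unfolding zr
    by (rule fin, use pos_t[of z] neg1 sgn[of z] rz de in linarith)
  show "exp (t * ((r - p) / (p - 1))) \<le> bound"
    unfolding wr
    by (rule fin, use pos_t[of w] neg2 sgn[of w] rw de in linarith)
qed

text \<open>
  Read with \<open>L = ln (1 / \<bar>Q\<bar>)\<close>, the two assumptions say that, up to a constant, the indicator of \<open>Q\<close>
  has norm \<open>\<bar>Q\<bar> powr mean_recip\<close> for the exponent \<open>p\<close> and \<open>\<bar>Q\<bar> powr (1 - mean_recip)\<close> for its
  conjugate.
\<close>

locale critical_exponent = bounded_exponent +
  fixes L B :: real
  assumes L_nonneg: "0 \<le> L" and B_ge_1: "1 \<le> B"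
    and critical: "(\<integral>x. exp (L * (p x * mean_recip - 1)) \<partial>M) \<le> B"
    and critical_conj: "(\<integral>x. exp (L * (p_conj x * (1 - mean_recip) - 1)) \<partial>M) \<le> B"
begin

lemma integrable_critical: "integrable M (\<lambda>x. exp (L * (p x * mean_recip - 1)))"
proof (rule integrable_exp)
  fix x
  have "\<bar>p x\<bar> * mean_recip \<le> b * 1"
    using p_abs_le[of x] mean_recip_bounds by (intro mult_mono) auto
  then have "\<bar>p x * mean_recip - 1\<bar> \<le> b * 1 + 1"
    using mean_recip_bounds abs_triangle_ineq4[of "p x * mean_recip" 1] by (simp add: abs_mult)
  then show "\<bar>L * (p x * mean_recip - 1)\<bar> \<le> L * (b * 1 + 1)"
    using L_nonneg by (simp add: abs_mult mult_left_mono)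
qed simp

lemma integrable_critical_conj: "integrable M (\<lambda>x. exp (L * (p_conj x * (1 - mean_recip) - 1)))"
proof (rule integrable_exp)
  fix x
  have "\<bar>p_conj x\<bar> * (1 - mean_recip) \<le> a / (a - 1) * 1"
    using conj_abs_le[of x] mean_recip_bounds one_less_a by (intro mult_mono) auto
  then have "\<bar>p_conj x * (1 - mean_recip) - 1\<bar> \<le> a / (a - 1) * 1 + 1"
    using mean_recip_bounds abs_triangle_ineq4[of "p_conj x * (1 - mean_recip)" 1]
    by (simp add: abs_mult)
  then show "\<bar>L * (p_conj x * (1 - mean_recip) - 1)\<bar> \<le> L * (a / (a - 1) * 1 + 1)"
    using L_nonneg by (simp only: abs_mult) (simp add: mult_left_mono)
qed simp

text \<open>
  Hoelder's inequality against the constant \<open>1\<close>. The test constant \<open>w\<close> is the critical one for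
  the conjugate exponent: its modular is \<open>exp L\<close> up to the factor \<open>B\<close>, which matches the bound for
  the modular of \<open>g\<close>.
\<close>

lemma nn_integral_le_of_modular:
  assumes [measurable]: "g \<in> borel_measurable M" and g: "\<And>x. 0 \<le> g x"
    and mod: "(\<integral>\<^sup>+x. ennreal (g x powr p x) \<partial>M) \<le> ennreal (exp L)"
  shows "(\<integral>\<^sup>+x. ennreal (g x) \<partial>M) \<le> ennreal ((1 + B) * exp (L * mean_recip))"
proof -
  define w where "w = exp (L * (1 - mean_recip))"
  have w: "0 < w" by (simp add: w_def)
  have wq: "w powr p_conj x = exp L * exp (L * (p_conj x * (1 - mean_recip) - 1))" for x
    by (simp add: w_def powr_def exp_add[symmetric] algebra_simps)
  have "ennreal w * (\<integral>\<^sup>+x. ennreal (g x) \<partial>M) = (\<integral>\<^sup>+x. ennreal (g x * w) \<partial>M)"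
    using g w by (simp add: nn_integral_cmult[symmetric] ennreal_mult mult.commute)
  also have "\<dots> \<le> (\<integral>\<^sup>+x. ennreal (g x powr p x) + ennreal (w powr p_conj x) \<partial>M)"
    using young[OF g less_imp_le[OF w]]
    by (intro nn_integral_mono) (simp add: ennreal_plus[symmetric] del: ennreal_plus)
  also have "\<dots> = (\<integral>\<^sup>+x. ennreal (g x powr p x) \<partial>M) + (\<integral>\<^sup>+x. ennreal (w powr p_conj x) \<partial>M)"
    by (intro nn_integral_add) auto
  also have "(\<integral>\<^sup>+x. ennreal (w powr p_conj x) \<partial>M)
      = ennreal (exp L) * ennreal (\<integral>x. exp (L * (p_conj x * (1 - mean_recip) - 1)) \<partial>M)"
    unfolding wq using integrable_critical_conj
    by (simp add: nn_integral_cmult ennreal_mult nn_integral_eq_integral)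
  also have "(\<integral>\<^sup>+x. ennreal (g x powr p x) \<partial>M)
      + ennreal (exp L) * ennreal (\<integral>x. exp (L * (p_conj x * (1 - mean_recip) - 1)) \<partial>M)
      \<le> ennreal (exp L) + ennreal (exp L) * ennreal B"
    using mod critical_conj by (intro add_mono mult_left_mono ennreal_leI) auto
  also have "\<dots> = ennreal (exp L * (1 + B))"
    using B_ge_1 by (simp add: ennreal_mult[symmetric] ennreal_plus[symmetric] distrib_left del: ennreal_plus)
  also have "exp L * (1 + B) = w * ((1 + B) * exp (L * mean_recip))"
    by (simp add: w_def exp_add[symmetric] algebra_simps)
  also have "ennreal (w * ((1 + B) * exp (L * mean_recip))) =
      ennreal w * ennreal ((1 + B) * exp (L * mean_recip))"
    using w B_ge_1 by (intro ennreal_mult) auto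
  finally show ?thesis
    using w by (simp add: ennreal_mult_le_mult_iff)
qed

lemma mean_exp_oscillation:
  fixes d t \<delta> :: real
  assumes d: "0 \<le> d" and \<delta>: "0 \<le> \<delta>" "\<delta> * (b * (b - 1)) \<le> 1" "\<delta> * b \<le> a - 1"
    and t: "- (\<delta> * L) \<le> t" "t \<le> L * mean_recip + d"
  defines "r \<equiv> 1 / mean_recip" and "C \<equiv> 1 + 2 * (exp (d * (b * (a / (a - 1)))) * B)"
  shows "integrable M (\<lambda>x. exp (t * (p x - r)))"
    and "(\<integral>x. exp (t * (p x - r)) \<partial>M) \<le> C"
    and "integrable M (\<lambda>x. exp (t * ((r - p x) / (p x - 1))))"
    and "(\<integral>x. exp (t * ((r - p x) / (p x - 1))) \<partial>M) \<le> C"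
proof -
  let ?E = "exp (d * (b * (a / (a - 1))))"
  define bound where "bound x = 1 + ?E * (exp (L * (p x * mean_recip - 1))
      + exp (L * (p_conj x * (1 - mean_recip) - 1)))" for x
  have s: "mean_recip = 1 / r" using mean_recip_bounds by (simp add: r_def)
  have r: "a \<le> r" "r \<le> b"
    using mean_recip_lower mean_recip_upper mean_recip_bounds one_less_a a_le_b
    by (auto simp: r_def field_simps)
  have int: "integrable M bound"
    unfolding bound_def using integrable_critical integrable_critical_conj by simp
  have "(\<integral>x. bound x \<partial>M) = 1 + ?E * ((\<integral>x. exp (L * (p x * mean_recip - 1)) \<partial>M)
      + (\<integral>x. exp (L * (p_conj x * (1 - mean_recip) - 1)) \<partial>M))"
    unfolding bound_def using integrable_critical integrable_critical_conj
    by (simp add: prob_space)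
  also have "\<dots> \<le> 1 + ?E * (B + B)"
    using critical critical_conj by (intro add_left_mono mult_left_mono add_mono) auto
  finally have C: "(\<integral>x. bound x \<partial>M) \<le> C" by (simp add: C_def)
  have le: "exp (t * (p x - r)) \<le> bound x" "exp (t * ((r - p x) / (p x - 1))) \<le> bound x" for x
    using exp_oscillation_pointwise[OF one_less_a p_lower p_upper r L_nonneg d \<delta>, of t x] t
    by (simp_all add: bound_def s p_conj_def)
  show 1: "integrable M (\<lambda>x. exp (t * (p x - r)))"
    by (rule Bochner_Integration.integrable_bound[OF int])
       (auto intro!: order_trans[OF le(1)] simp del: times_divide_eq_right)
  show 2: "integrable M (\<lambda>x. exp (t * ((r - p x) / (p x - 1))))"
    by (rule Bochner_Integration.integrable_bound[OF int])
       (auto intro!: order_trans[OF le(2)] simp del: times_divide_eq_right)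
  show "(\<integral>x. exp (t * (p x - r)) \<partial>M) \<le> C"
    using integral_mono[OF 1 int le(1)] C by simp
  show "(\<integral>x. exp (t * ((r - p x) / (p x - 1))) \<partial>M) \<le> C"
    using integral_mono[OF 2 int le(2)] C by simp
qed

text \<open>
  For a constant exponent this is Jensen's inequality. In general the average of \<open>f powr p\<close> is
  bounded from below by testing \<open>f\<close> against a constant in Young's inequality. The best constant is
  comparable to the average \<open>v\<close> of \<open>m powr (p - 1)\<close>; the additional factor \<open>\<kappa>\<close> makes the dual
  modular \<open>(\<kappa> * v) powr p_conj\<close> cost only half of the gain \<open>\<kappa> * v * m\<close>. Since every value of
  \<open>p_conj\<close> is at least \<open>b / (b - 1) > 1\<close>, decreasing \<open>\<kappa>\<close> decreases the cost faster than the gain.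
\<close>

lemma modular_Jensen:
  fixes d \<delta> m :: real
  assumes d: "0 \<le> d" and \<delta>: "0 \<le> \<delta>" "\<delta> * (b * (b - 1)) \<le> 1" "\<delta> * b \<le> a - 1"
    and [measurable]: "f \<in> borel_measurable M" and f: "\<And>x. 0 \<le> f x"
    and m: "(\<integral>\<^sup>+x. ennreal (f x) \<partial>M) = ennreal m"
    and m_bounds: "exp (- (\<delta> * L)) \<le> m" "m \<le> exp (L * mean_recip + d)"
  defines "C \<equiv> 1 + 2 * (exp (d * (b * (a / (a - 1)))) * B)"
  shows "(\<integral>\<^sup>+x. ennreal (m powr p x) \<partial>M)
    \<le> ennreal (2 * (2 * C powr (a / (a - 1))) powr (b - 1)) * (\<integral>\<^sup>+x. ennreal (f x powr p x) \<partial>M)"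
proof -
  define r where "r = 1 / mean_recip"
  define t where "t = ln m"
  define A where "A = (\<integral>x. exp (t * (p x - r)) \<partial>M)"
  define v where "v = exp (t * (r - 1)) * A"
  define a' where "a' = a / (a - 1)"
  define K where "K = 2 * C powr a'"
  \<comment> \<open>This is the solution of \<open>\<kappa> powr (b / (b - 1)) = \<kappa> / K\<close>.\<close>
  define \<kappa> where "\<kappa> = K powr (1 - b)"
  have m0: "0 < m" using m_bounds(1) exp_gt_zero[of "- (\<delta> * L)"] by linarith
  then have mt: "m = exp t" by (simp add: t_def)
  have t: "- (\<delta> * L) \<le> t" "t \<le> L * mean_recip + d"
    using m_bounds unfolding mt by auto
  note osc = mean_exp_oscillation[OF d \<delta> t, folded r_def C_def]
  have C1: "1 \<le> C" using B_ge_1 by (simp add: C_def)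
  have A0: "0 \<le> A" unfolding A_def by (rule integral_nonneg_AE) simp
  have AC: "A \<le> C" using osc(2) by (simp add: A_def)
  have v0: "0 \<le> v" using A0 by (simp add: v_def)
  have a'1: "1 < a'" using one_less_a by (simp add: a'_def)
  have b1: "1 < b" using one_less_a a_le_b by simp
  have K1: "1 \<le> K" using C1 a'1 ge_one_powr_ge_zero[of C a'] by (simp add: K_def)
  have \<kappa>0: "0 < \<kappa>" using K1 by (simp add: \<kappa>_def)
  have \<kappa>1: "\<kappa> \<le> 1" using K1 b1 powr_mono[of "1 - b" 0 K] by (simp add: \<kappa>_def)
  have q: "b / (b - 1) \<le> p_conj x" "p_conj x \<le> a'" "1 < p_conj x" for x
    using bounded_exponent.p_lower[OF conj_exponent_bounded, of x] bounded_exponent.p_upper[OF conj_exponent_bounded, of x]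
      bounded_exponent.p_gt_1[OF conj_exponent_bounded, of x] by (simp_all add: a'_def)
  have mp: "m powr p x = m * exp (t * (r - 1)) * exp (t * (p x - r))" for x
    by (simp add: mt powr_def exp_add[symmetric] algebra_simps)
  have lhs: "(\<integral>\<^sup>+x. ennreal (m powr p x) \<partial>M) = ennreal (m * v)"
  proof -
    have "(\<integral>\<^sup>+x. ennreal (m powr p x) \<partial>M) = ennreal (\<integral>x. m powr p x \<partial>M)"
      unfolding mp using osc(1) m0 by (intro nn_integral_eq_integral) auto
    also have "(\<integral>x. m powr p x \<partial>M) = m * v"
      unfolding mp v_def A_def by simp
    finally show ?thesis .
  qed
  have dual: "(\<kappa> * v) powr p_conj x \<le> \<kappa> / (2 * C) * (m * v) * exp (t * ((r - p x) / (p x - 1)))" for x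
  proof -
    \<comment> \<open>Splits off the homogeneous part: the oscillation of the conjugate exponent,
      \<open>(r - 1) * p_conj - r\<close>, equals \<open>(r - p) / (p - 1)\<close>.\<close>
    have e: "t * (r - 1) * p_conj x = t + t * (r - 1) + t * ((r - p x) / (p x - 1))"
      using p_gt_1[of x] by (simp add: p_conj_def field_simps)
    have "(\<kappa> * v) powr p_conj x = \<kappa> powr p_conj x * A powr p_conj x * exp (t * (r - 1) * p_conj x)"
      using \<kappa>0 A0 by (simp add: v_def powr_mult powr_def[of "exp _"] mult.commute)
    also have "exp (t * (r - 1) * p_conj x)
        = m * exp (t * (r - 1)) * exp (t * ((r - p x) / (p x - 1)))"
      unfolding e exp_add by (simp add: mt)
    also have "\<kappa> powr p_conj x * A powr p_conj x * (m * exp (t * (r - 1)) * exp (t * ((r - p x) / (p x - 1))))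
        \<le> (\<kappa> / K) * (A * C powr (a' - 1)) * (m * exp (t * (r - 1)) * exp (t * ((r - p x) / (p x - 1))))"
    proof (intro mult_right_mono mult_mono)
      have "\<kappa> powr p_conj x \<le> \<kappa> powr (b / (b - 1))"
        using q \<kappa>0 \<kappa>1 by (intro powr_mono') auto
      also have "\<dots> = K powr (- b)"
      proof -
        have "(1 - b) * (b / (b - 1)) = - b" using b1 by (simp add: field_simps)
        then show ?thesis by (simp only: \<kappa>_def powr_powr)
      qed
      also have "\<dots> = \<kappa> / K"
        using K1 by (simp add: \<kappa>_def powr_diff powr_minus field_simps)
      finally show "\<kappa> powr p_conj x \<le> \<kappa> / K" .
      show "A powr p_conj x \<le> A * C powr (a' - 1)"
      proof (cases "A = 0")
        case False
        then have "A powr p_conj x = A * A powr (p_conj x - 1)"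
          using A0 by (simp add: powr_diff)
        also have "\<dots> \<le> A * C powr (p_conj x - 1)"
          using A0 AC q(3)[of x] by (intro mult_left_mono powr_mono2) auto
        also have "\<dots> \<le> A * C powr (a' - 1)"
          using A0 C1 q(2)[of x] by (intro mult_left_mono powr_mono) auto
        finally show ?thesis .
      qed simp
    qed (use \<kappa>0 K1 m0 in auto)
    also have "\<dots> = \<kappa> / (2 * C) * (m * v) * exp (t * ((r - p x) / (p x - 1)))"
      using C1 by (simp add: K_def v_def powr_diff)
    finally show ?thesis .
  qed
  have "ennreal (\<kappa> * v * m) = (\<integral>\<^sup>+x. ennreal (f x * (\<kappa> * v)) \<partial>M)"
    using \<kappa>0 v0 m0 f by (simp add: ennreal_mult' m nn_integral_multc mult.commute)
  also have "\<dots> \<le> (\<integral>\<^sup>+x. ennreal (f x powr p x)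
      + ennreal (\<kappa> / (2 * C) * (m * v) * exp (t * ((r - p x) / (p x - 1)))) \<partial>M)"
  proof (intro nn_integral_mono)
    fix x
    have "f x * (\<kappa> * v) \<le> f x powr p x + (\<kappa> * v) powr p_conj x"
      using f \<kappa>0 v0 by (intro young) auto
    also have "\<dots> \<le> f x powr p x + \<kappa> / (2 * C) * (m * v) * exp (t * ((r - p x) / (p x - 1)))"
      using dual by simp
    finally show "ennreal (f x * (\<kappa> * v)) \<le> ennreal (f x powr p x)
      + ennreal (\<kappa> / (2 * C) * (m * v) * exp (t * ((r - p x) / (p x - 1))))"
      using \<kappa>0 C1 m0 v0 f
      by (subst ennreal_plus[symmetric]) (auto intro!: ennreal_leI simp del: ennreal_plus)
  qed
  also have "\<dots> = (\<integral>\<^sup>+x. ennreal (f x powr p x) \<partial>M)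
      + (\<integral>\<^sup>+x. ennreal (\<kappa> / (2 * C) * (m * v) * exp (t * ((r - p x) / (p x - 1)))) \<partial>M)"
    by (intro nn_integral_add) auto
  also have "(\<integral>\<^sup>+x. ennreal (\<kappa> / (2 * C) * (m * v) * exp (t * ((r - p x) / (p x - 1)))) \<partial>M)
      = ennreal (\<integral>x. \<kappa> / (2 * C) * (m * v) * exp (t * ((r - p x) / (p x - 1))) \<partial>M)"
    using \<kappa>0 C1 m0 v0 osc(3) by (intro nn_integral_eq_integral integrable_mult_right) auto
  also have "(\<integral>x. \<kappa> / (2 * C) * (m * v) * exp (t * ((r - p x) / (p x - 1))) \<partial>M)
      = \<kappa> / (2 * C) * (m * v) * (\<integral>x. exp (t * ((r - p x) / (p x - 1))) \<partial>M)"
    by simp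
  also have "(\<integral>\<^sup>+x. ennreal (f x powr p x) \<partial>M) + ennreal \<dots>
     \<le> (\<integral>\<^sup>+x. ennreal (f x powr p x) \<partial>M) + ennreal (\<kappa> / (2 * C) * (m * v) * C)"
    using osc(4) \<kappa>0 C1 m0 v0 by (intro add_left_mono ennreal_leI mult_left_mono) auto
  also have "\<kappa> / (2 * C) * (m * v) * C = \<kappa> / 2 * (m * v)"
    using C1 by simp
  finally have main: "ennreal (\<kappa> * v * m) \<le> (\<integral>\<^sup>+x. ennreal (f x powr p x) \<partial>M) + ennreal (\<kappa> / 2 * (m * v))" .
  have half: "ennreal (\<kappa> / 2 * (m * v)) \<le> (\<integral>\<^sup>+x. ennreal (f x powr p x) \<partial>M)"
  proof -
    have "ennreal (\<kappa> * v * m) = ennreal (\<kappa> / 2 * (m * v)) + ennreal (\<kappa> / 2 * (m * v))"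
      using \<kappa>0 v0 m0 by (subst ennreal_plus[symmetric]) (auto simp: field_simps)
    with main show ?thesis by (simp add: add.commute)
  qed
  have "2 * K powr (b - 1) * (\<kappa> / 2 * (m * v)) = (K powr (b - 1) * \<kappa>) * (m * v)" by simp
  also have "K powr (b - 1) * \<kappa> = 1"
    using K1 by (simp add: \<kappa>_def powr_add[symmetric])
  finally have "ennreal (m * v) = ennreal (2 * K powr (b - 1)) * ennreal (\<kappa> / 2 * (m * v))"
    using \<kappa>0 v0 m0 by (subst ennreal_mult[symmetric]) auto
  also have "\<dots> \<le> ennreal (2 * K powr (b - 1)) * (\<integral>\<^sup>+x. ennreal (f x powr p x) \<partial>M)"
    using half by (intro mult_left_mono) auto
  finally show ?thesis
    unfolding lhs by (simp add: K_def a'_def)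
qed

text \<open>
  Below the level \<open>exp (- (\<delta> * L))\<close> the oscillation of \<open>p\<close> is no longer controlled, but there
  \<open>m \<le> 1\<close> and therefore \<open>m powr p \<le> m\<close>.
\<close>

lemma modular_Jensen_error:
  fixes d \<delta> m :: real
  assumes d: "0 \<le> d" and \<delta>: "0 \<le> \<delta>" "\<delta> * (b * (b - 1)) \<le> 1" "\<delta> * b \<le> a - 1"
    and [measurable]: "f \<in> borel_measurable M" and f: "\<And>x. 0 \<le> f x"
    and m: "(\<integral>\<^sup>+x. ennreal (f x) \<partial>M) = ennreal m"
    and m_bounds: "0 \<le> m" "m \<le> exp (L * mean_recip + d)"
  defines "C \<equiv> 1 + 2 * (exp (d * (b * (a / (a - 1)))) * B)"
  shows "(\<integral>\<^sup>+x. ennreal (m powr p x) \<partial>M)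
    \<le> ennreal (2 * (2 * C powr (a / (a - 1))) powr (b - 1)) * (\<integral>\<^sup>+x. ennreal (f x powr p x) \<partial>M)
      + ennreal (exp (- (\<delta> * L)))"
proof (cases "exp (- (\<delta> * L)) \<le> m")
  case True
  show ?thesis
    by (rule order_trans[OF modular_Jensen[OF d \<delta> assms(5) f m True m_bounds(2)]])
       (simp add: C_def)
next
  case False
  have "exp (- (\<delta> * L)) \<le> 1" using \<delta> L_nonneg by simp
  then have m1: "m \<le> 1" using False by linarith
  have "(\<integral>\<^sup>+x. ennreal (m powr p x) \<partial>M) \<le> (\<integral>\<^sup>+x. ennreal (exp (- (\<delta> * L))) \<partial>M)"
  proof (intro nn_integral_mono ennreal_leI)
    fix x
    have "m powr p x \<le> m powr 1"
      using m_bounds m1 p_gt_1[of x] by (intro powr_mono') auto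
    also have "\<dots> \<le> exp (- (\<delta> * L))" using False m_bounds by simp
    finally show "m powr p x \<le> exp (- (\<delta> * L))" .
  qed
  also have "\<dots> = ennreal (exp (- (\<delta> * L)))" by (simp add: emeasure_space_1)
  finally show ?thesis by (rule add_increasing[OF zero_le])
qed

end

section \<open>Exponents on a cube of measure at most one\<close>

lemma epower_ereal: "0 \<le> t \<Longrightarrow> epower (ennreal t) (ereal q) = ennreal (t powr q)"
  by (simp add: epower_def)

lemma var_norm_less:
  assumes "var_norm q f < ennreal k"
  obtains l where "0 < l" "l < k" "modular q (\<lambda>x. f x / l) \<le> 1"
proof -
  from assms obtain l where l: "0 < l" "ennreal l < ennreal k" "modular q (\<lambda>x. f x / l) \<le> 1"
    unfolding var_norm_def Inf_less_iff by auto
  then have "l < k" by (simp add: ennreal_less_iff)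
  with l show ?thesis using that by blast
qed

lemma cube_compact: "Q \<in> cubes \<Longrightarrow> compact Q"
  by (auto simp: cubes_def)

lemma cube_emeasure_pos:
  fixes Q :: "(real ^ 'n) set"
  assumes "Q \<in> cubes"
  shows "0 < emeasure lebesgue Q"
proof -
  from assms obtain a :: "real^'n" and l :: real where Q: "Q = cbox a (\<chi> i. a $ i + l)" "l > 0"
    by (auto simp: cubes_def)
  have "box a (\<chi> i. a $ i + l) \<noteq> {}"
    using Q(2) by (auto simp: interval_ne_empty_cart)
  then have "0 < measure lebesgue Q"
    unfolding Q using content_pos_lt_eq[of a "\<chi> i. a $ i + l"] by (simp add: box_ne_empty)
  then show ?thesis by (auto simp: measure_def zero_less_iff_neq_zero)
qed

locale cube_exponent =
  fixes Q :: "(real ^ 'n) set" and p :: "real ^ 'n \<Rightarrow> real" and a b :: real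
  assumes cube: "Q \<in> cubes" and small: "emeasure lebesgue Q \<le> 1"
    and meas_p [measurable]: "p \<in> borel_measurable lebesgue"
    and one_less: "1 < a" and lower: "\<And>x. a \<le> p x" and upper: "\<And>x. p x \<le> b"
begin

abbreviation "avg \<equiv> uniform_measure lebesgue Q"

definition "L = - ln (measure lebesgue Q)"

lemma Q_sets [measurable]: "Q \<in> sets lebesgue"
  by (intro lmeasurable_compact[THEN fmeasurableD] cube_compact[OF cube])

lemma emeasure_Q: "emeasure lebesgue Q = ennreal (exp (- L))"
  and measure_Q: "measure lebesgue Q = exp (- L)"
  and L_nonneg: "0 \<le> L"
proof -
  have fin: "emeasure lebesgue Q = ennreal (measure lebesgue Q)"
    using small by (intro emeasure_eq_ennreal_measure) (auto simp: top_unique)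
  have pos: "0 < measure lebesgue Q"
    using cube_emeasure_pos[OF cube] by (simp add: fin)
  show "measure lebesgue Q = exp (- L)" using pos by (simp add: L_def)
  with fin show "emeasure lebesgue Q = ennreal (exp (- L))" by simp
  show "0 \<le> L" using small pos by (simp add: fin L_def)
qed

lemma prob_space_avg: "prob_space avg"
  by (rule prob_space_uniform_measure) (simp_all add: emeasure_Q)

lemma measurable_avg [simp]: "borel_measurable avg = borel_measurable lebesgue"
  by (rule measurable_cong_sets) simp_all

sublocale bounded_exponent avg p a b
proof -
  interpret prob_space avg by (rule prob_space_avg)
  show "bounded_exponent avg p a b"
    by standard (use one_less lower upper in auto)
qed

lemma nn_integral_avg:
  assumes "g \<in> borel_measurable lebesgue"
  shows "(\<integral>\<^sup>+x. g x \<partial>avg) = (\<integral>\<^sup>+x\<in>Q. g x \<partial>lebesgue) / emeasure lebesgue Q"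
  using assms by (rule nn_integral_uniform_measure) simp

lemma nn_integral_avg_le:
  assumes "g \<in> borel_measurable lebesgue" and "(\<integral>\<^sup>+x\<in>Q. g x \<partial>lebesgue) \<le> 1"
  shows "(\<integral>\<^sup>+x. g x \<partial>avg) \<le> ennreal (exp L)"
proof -
  have "(\<integral>\<^sup>+x. g x \<partial>avg) \<le> 1 / emeasure lebesgue Q"
    unfolding nn_integral_avg[OF assms(1)] by (rule divide_right_mono_ennreal[OF assms(2)])
  also have "\<dots> = ennreal (exp L)"
    by (simp add: emeasure_Q ennreal_1[symmetric] divide_ennreal exp_minus inverse_eq_divide del: ennreal_1)
  finally show ?thesis .
qed

lemma integrable_exp_affine: "integrable avg (\<lambda>x. exp (y * p x - c))"
proof (rule integrable_exp)
  show "\<bar>y * p x - c\<bar> \<le> \<bar>y\<bar> * b + \<bar>c\<bar>" for x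
    using mult_left_mono[OF p_abs_le, of "\<bar>y\<bar>" x] abs_triangle_ineq4[of "y * p x" c]
    by (simp add: abs_mult)
qed simp

text \<open>Translates admissibility of \<open>l\<close> in the norm of the indicator of \<open>Q\<close> into an average over \<open>Q\<close>,
  the form used by \<open>mean_recip_critical\<close> with \<open>y = - ln l\<close>.\<close>

lemma modular_indicator:
  assumes l: "0 < l" and mod: "modular (\<lambda>x. ereal (p x)) (\<lambda>x. indicator Q x / l) \<le> 1"
  shows "(\<integral>x. exp (- ln l * p x - L) \<partial>avg) \<le> 1"
proof -
  have eq: "epower (ennreal \<bar>indicator Q x / l\<bar>) (ereal (p x)) = ennreal (exp (- ln l * p x)) * indicator Q x" for x
    using l p_gt_1[of x] epower_ereal[of 0 "p x"]
    by (cases "x \<in> Q") (simp_all add: epower_ereal powr_def ln_div mult.commute)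
  have "(\<integral>\<^sup>+x. ennreal (exp (- ln l * p x)) \<partial>avg) \<le> ennreal (exp L)"
    using mod unfolding modular_def eq by (intro nn_integral_avg_le) simp_all
  also have "(\<integral>\<^sup>+x. ennreal (exp (- ln l * p x)) \<partial>avg) = ennreal (\<integral>x. exp (- ln l * p x) \<partial>avg)"
    using integrable_exp_affine[of "- ln l" 0] by (intro nn_integral_eq_integral) auto
  finally have "(\<integral>x. exp (- ln l * p x) \<partial>avg) \<le> exp L" by simp
  then show ?thesis by (simp add: exp_diff)
qed

lemma var_norm_indicator_ge:
  "ennreal (exp (- (L * mean_recip))) \<le> var_norm (\<lambda>x. ereal (p x)) (indicator Q)"
  unfolding var_norm_def
proof (rule Inf_greatest, clarify)
  fix l :: real assume l: "0 < l" and mod: "modular (\<lambda>x. ereal (p x)) (\<lambda>x. indicator Q x / l) \<le> 1"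
  have "- ln l \<le> L * mean_recip"
    using L_nonneg modular_indicator[OF l mod] by (rule mean_recip_critical)
  then have "exp (- (L * mean_recip)) \<le> exp (ln l)" by simp
  then show "ennreal (exp (- (L * mean_recip))) \<le> ennreal l" using l by simp
qed

text \<open>
  The infimum in the norm need not be attained a priori, so a scaling \<open>l\<close> below twice the given
  bound is used; replacing \<open>l\<close> by that bound costs at most \<open>(2 * K) powr p\<close> in the modular.
\<close>

lemma critical_of_var_norm_indicator_le:
  assumes K: "1 \<le> K"
    and le: "var_norm (\<lambda>x. ereal (p x)) (indicator Q) \<le> ennreal (K * exp (- (L * mean_recip)))"
  shows "(\<integral>x. exp (L * (p x * mean_recip - 1)) \<partial>avg) \<le> (2 * K) powr b"
proof -
  have "var_norm (\<lambda>x. ereal (p x)) (indicator Q) < ennreal (2 * K * exp (- (L * mean_recip)))"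
    using le K by (elim order.strict_trans1) (simp add: ennreal_less_iff)
  then obtain l where l: "0 < l" "l < 2 * K * exp (- (L * mean_recip))"
    and mod: "modular (\<lambda>x. ereal (p x)) (\<lambda>x. indicator Q x / l) \<le> 1"
    by (rule var_norm_less)
  have "ln l \<le> ln (2 * K * exp (- (L * mean_recip)))"
    using l K by (subst ln_le_cancel_iff) auto
  also have "\<dots> = ln (2 * K) - L * mean_recip" using K by (simp add: ln_mult)
  finally have y: "L * mean_recip \<le> ln (2 * K) + (- ln l)" by simp
  have "(\<integral>x. exp (L * (p x * mean_recip - 1)) \<partial>avg)
      \<le> (\<integral>x. (2 * K) powr b * exp (- ln l * p x - L) \<partial>avg)"
  proof (rule integral_mono)
    show "integrable avg (\<lambda>x. exp (L * (p x * mean_recip - 1)))"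
      using integrable_exp_affine[of "L * mean_recip" L] by (simp add: algebra_simps)
    show "integrable avg (\<lambda>x. (2 * K) powr b * exp (- ln l * p x - L))"
      by (intro integrable_mult_right integrable_exp_affine)
    fix x
    have "L * mean_recip * p x \<le> (ln (2 * K) + (- ln l)) * p x"
      using y p_gt_1[of x] by (intro mult_right_mono) auto
    moreover have "ln (2 * K) * p x \<le> ln (2 * K) * b"
      using p_upper[of x] K by (intro mult_left_mono) auto
    ultimately have "L * (p x * mean_recip - 1) \<le> ln (2 * K) * b + (- ln l * p x - L)"
      by (simp add: algebra_simps)
    then have "exp (L * (p x * mean_recip - 1)) \<le> exp (ln (2 * K) * b + (- ln l * p x - L))" by simp
    also have "\<dots> = (2 * K) powr b * exp (- ln l * p x - L)"
      using K by (simp only: exp_add) (simp add: powr_def mult.commute)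
    finally show "exp (L * (p x * mean_recip - 1)) \<le> (2 * K) powr b * exp (- ln l * p x - L)" .
  qed
  also have "\<dots> = (2 * K) powr b * (\<integral>x. exp (- ln l * p x - L) \<partial>avg)" by simp
  also have "\<dots> \<le> (2 * K) powr b * 1"
    by (intro mult_left_mono modular_indicator[OF l(1) mod]) simp
  finally show ?thesis by simp
qed

lemma cube_exponent_conj: "cube_exponent Q p_conj (b / (b - 1)) (a / (a - 1))"
proof -
  interpret c: bounded_exponent avg p_conj "b / (b - 1)" "a / (a - 1)"
    by (rule conj_exponent_bounded)
  show ?thesis
    using cube small c.one_less_a c.p_lower c.p_upper c.measurable_p by unfold_locales auto
qed

lemma conj_exponent_ereal: "conj_exponent (\<lambda>x. ereal (p x)) = (\<lambda>x. ereal (p_conj x))"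
proof
  fix x
  show "conj_exponent (\<lambda>x. ereal (p x)) x = ereal (p_conj x)"
    using p_gt_1[of x] by (simp add: conj_exponent_def p_conj_def divide_ereal_def one_ereal_def field_simps)
qed

text \<open>
  The lower bounds of \<open>var_norm_indicator_ge\<close> for \<open>p\<close> and its conjugate have product \<open>\<bar>Q\<bar>\<close>.
  Dividing the bound for the product of the two norms by either of them gives the matching upper
  bound for the other norm.
\<close>

lemma critical_exponent_of_A:
  assumes K: "1 \<le> K" and A: "A_const (\<lambda>x. ereal (p x)) \<le> ennreal K"
  shows "critical_exponent avg p a b L ((2 * K) powr (b + a / (a - 1)))"
proof -
  interpret c: cube_exponent Q p_conj "b / (b - 1)" "a / (a - 1)" by (rule cube_exponent_conj)
  define N1 where "N1 = var_norm (\<lambda>x. ereal (p x)) (indicator Q)"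
  define N2 where "N2 = var_norm (\<lambda>x. ereal (p_conj x)) (indicator Q)"
  have N1: "ennreal (exp (- (L * mean_recip))) \<le> N1"
    unfolding N1_def by (rule var_norm_indicator_ge)
  have N2: "ennreal (exp (- (L * (1 - mean_recip)))) \<le> N2"
    using c.var_norm_indicator_ge unfolding N2_def mean_recip_conj .
  have "N1 * N2 / emeasure lebesgue Q \<le> A_const (\<lambda>x. ereal (p x))"
    unfolding A_const_def N1_def N2_def conj_exponent_ereal[symmetric] by (rule SUP_upper[OF cube])
  with A have "N1 * N2 / ennreal (exp (- L)) \<le> ennreal K"
    unfolding emeasure_Q by simp
  then have "N1 * N2 / ennreal (exp (- L)) * ennreal (exp (- L)) \<le> ennreal K * ennreal (exp (- L))"
    by (rule mult_right_mono) simp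
  then have prod: "N1 * N2 \<le> ennreal K * ennreal (exp (- L))"
    by (simp add: ennreal_divide_times ennreal_mult_divide_eq)
  have cancel: "N \<le> ennreal (K * exp (- (L * s)))"
    if N': "ennreal (exp (- (L * (1 - s)))) \<le> N'" and NN: "N * N' \<le> ennreal K * ennreal (exp (- L))"
    for N N' s
  proof -
    have "N * ennreal (exp (- (L * (1 - s)))) \<le> N * N'" by (intro mult_left_mono N') simp
    also note NN
    also have "ennreal K * ennreal (exp (- L)) = ennreal (K * exp (- (L * s)) * exp (- (L * (1 - s))))"
      using K by (simp add: ennreal_mult[symmetric] exp_add[symmetric] algebra_simps)
    also have "\<dots> = ennreal (K * exp (- (L * s))) * ennreal (exp (- (L * (1 - s))))"
      using K by (intro ennreal_mult) auto
    finally show ?thesis by (simp add: mult.commute[of _ "ennreal (exp (- (L * (1 - s))))"] ennreal_mult_le_mult_iff)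
  qed
  have a': "0 < a / (a - 1)" "0 < b" using one_less a_le_b by auto
  have B: "(2 * K) powr b \<le> (2 * K) powr (b + a / (a - 1))"
    "(2 * K) powr (a / (a - 1)) \<le> (2 * K) powr (b + a / (a - 1))"
    using K a' by (auto intro!: powr_mono)
  show ?thesis
  proof (unfold_locales)
    show "1 \<le> (2 * K) powr (b + a / (a - 1))"
      using K a' by (intro ge_one_powr_ge_zero) auto
    show "(\<integral>x. exp (L * (p x * mean_recip - 1)) \<partial>avg) \<le> (2 * K) powr (b + a / (a - 1))"
      using critical_of_var_norm_indicator_le[OF K cancel[OF N2 prod, unfolded N1_def]] B by linarith
    have "N2 \<le> ennreal (K * exp (- (L * (1 - mean_recip))))"
      by (rule cancel[of "1 - mean_recip" N1]) (use N1 prod in \<open>auto simp: mult.commute\<close>)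
    then show "(\<integral>x. exp (L * (p_conj x * (1 - mean_recip) - 1)) \<partial>avg) \<le> (2 * K) powr (b + a / (a - 1))"
      using c.critical_of_var_norm_indicator_le[OF K] B
      unfolding N2_def mean_recip_conj by fastforce
  qed (rule L_nonneg)
qed

text \<open>
  A near-optimal splitting \<open>f = g + h\<close> has both norms below \<open>2\<close>. Measurability is recorded on \<open>Q\<close>,
  where local integrability of \<open>g\<close> yields it.
\<close>

lemma sum_norm_decompose:
  assumes "sum_norm (\<lambda>x. ereal (p x)) f \<le> 1"
  obtains g l where "(\<lambda>x. indicator Q x * \<bar>g x\<bar>) \<in> borel_measurable lebesgue"
    and "(\<lambda>x. indicator Q x * \<bar>f x\<bar>) \<in> borel_measurable lebesgue"
    and "0 < l" "l < 2"
    and "modular (\<lambda>x. ereal (p x)) (\<lambda>x. g x / l) \<le> 1"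
    and "AE x in lebesgue. \<bar>f x\<bar> \<le> \<bar>g x\<bar> + 2"
proof -
  have "sum_norm (\<lambda>x. ereal (p x)) f < 2"
    using assms by (rule order.strict_trans1) simp
  then obtain g h where g: "g \<in> var_Lspace (\<lambda>x. ereal (p x))" and h: "h \<in> Linf_space"
    and f: "\<And>x. f x = g x + h x" and lt: "var_norm (\<lambda>x. ereal (p x)) g + Linf_norm h < 2"
    unfolding sum_norm_def Inf_less_iff by auto
  have "var_norm (\<lambda>x. ereal (p x)) g < ennreal 2"
    by (rule order.strict_trans1[OF _ lt[folded ennreal_numeral]]) simp
  then obtain l where l: "0 < l" "l < 2" "modular (\<lambda>x. ereal (p x)) (\<lambda>x. g x / l) \<le> 1"
    by (rule var_norm_less)
  have h_le: "Linf_norm h \<le> 2"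
    by (rule order.trans[OF _ less_imp_le[OF lt]]) simp
  have "AE x in lebesgue. ennreal \<bar>h x\<bar> \<le> Linf_norm h"
    unfolding Linf_norm_def by (rule esssup_AE)
  then have ae: "AE x in lebesgue. \<bar>f x\<bar> \<le> \<bar>g x\<bar> + 2"
  proof eventually_elim
    case (elim x)
    then have "ennreal \<bar>h x\<bar> \<le> ennreal 2" using h_le by simp
    then have "\<bar>h x\<bar> \<le> 2" by (simp del: ennreal_numeral)
    then show ?case unfolding f by linarith
  qed
  have "g absolutely_integrable_on Q"
    using g cube_compact[OF cube] by (auto simp: var_Lspace_def locally_L1_def)
  then have gm [measurable]: "(\<lambda>x. indicator Q x * g x) \<in> borel_measurable lebesgue"
    by (simp add: set_integrable_def borel_measurable_integrable)
  have hm [measurable]: "h \<in> borel_measurable lebesgue" using h by (simp add: Linf_space_def)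
  have "(\<lambda>x. \<bar>indicator Q x * g x\<bar>) \<in> borel_measurable lebesgue" by measurable
  moreover have "(\<lambda>x. \<bar>indicator Q x * g x + indicator Q x * h x\<bar>) \<in> borel_measurable lebesgue" by measurable
  ultimately show ?thesis
    using that[of g l] l ae by (simp add: abs_mult f distrib_left[symmetric])
qed

text \<open>
  This is the only place where the size of \<open>f\<close> matters. The contribution of the bounded part is
  absorbed because \<open>exp (L * mean_recip) \<ge> 1\<close>.
\<close>

lemma average_le:
  assumes crit: "critical_exponent avg p a b L B"
    and f: "sum_norm (\<lambda>x. ereal (p x)) f \<le> 1"
  shows "(\<integral>\<^sup>+x. ennreal (indicator Q x * \<bar>f x\<bar>) \<partial>avg)
    \<le> ennreal (exp (L * mean_recip + ln (2 * (2 + B))))"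
proof -
  interpret critical_exponent avg p a b L B by (rule crit)
  obtain g l where gm [measurable]: "(\<lambda>x. indicator Q x * \<bar>g x\<bar>) \<in> borel_measurable lebesgue"
    and l: "0 < l" "l < 2" and mod: "modular (\<lambda>x. ereal (p x)) (\<lambda>x. g x / l) \<le> 1"
    and ae: "AE x in lebesgue. \<bar>f x\<bar> \<le> \<bar>g x\<bar> + 2"
    by (rule sum_norm_decompose[OF f])
  define G where "G x = indicator Q x * \<bar>g x\<bar> / l" for x
  have G [measurable]: "G \<in> borel_measurable lebesgue" unfolding G_def by simp
  have G0: "0 \<le> G x" for x using l by (simp add: G_def)
  have "(\<integral>\<^sup>+x\<in>Q. ennreal (G x powr p x) \<partial>lebesgue) \<le> modular (\<lambda>x. ereal (p x)) (\<lambda>x. g x / l)"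
    unfolding modular_def using l
    by (intro nn_integral_mono) (auto simp: epower_ereal G_def split: split_indicator)
  then have "(\<integral>\<^sup>+x. ennreal (G x powr p x) \<partial>avg) \<le> ennreal (exp L)"
    using mod by (intro nn_integral_avg_le) auto
  then have GG: "(\<integral>\<^sup>+x. ennreal (G x) \<partial>avg) \<le> ennreal ((1 + B) * exp (L * mean_recip))"
    by (intro nn_integral_le_of_modular G0) auto
  have "(\<integral>\<^sup>+x. ennreal (indicator Q x * \<bar>f x\<bar>) \<partial>avg) \<le> (\<integral>\<^sup>+x. ennreal 2 * ennreal (G x) + ennreal 2 \<partial>avg)"
  proof (rule nn_integral_mono_AE)
    have "AE x in lebesgue. x \<in> Q \<longrightarrow> ennreal (indicator Q x * \<bar>f x\<bar>) \<le> ennreal 2 * ennreal (G x) + ennreal 2"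
      using ae
    proof eventually_elim
      case (elim x)
      have "x \<in> Q \<Longrightarrow> indicator Q x * \<bar>f x\<bar> \<le> l * G x + 2" using elim l by (simp add: G_def)
      moreover have "l * G x \<le> 2 * G x" using l G0 by (intro mult_right_mono) auto
      ultimately have "x \<in> Q \<Longrightarrow> indicator Q x * \<bar>f x\<bar> \<le> 2 * G x + 2" by linarith
      then show ?case using G0
        by (auto simp: ennreal_mult[symmetric] ennreal_plus[symmetric] simp del: ennreal_plus ennreal_numeral
            intro!: ennreal_leI)
    qed
    then show "AE x in avg. ennreal (indicator Q x * \<bar>f x\<bar>) \<le> ennreal 2 * ennreal (G x) + ennreal 2"
      by (intro AE_uniform_measureI) auto
  qed
  also have "\<dots> = ennreal 2 * (\<integral>\<^sup>+x. ennreal (G x) \<partial>avg) + ennreal 2"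
  proof -
    have "(\<integral>\<^sup>+x. ennreal 2 \<partial>avg) = ennreal 2"
      by (simp only: nn_integral_const emeasure_space_1 mult_1_right)
    moreover have "(\<integral>\<^sup>+x. ennreal 2 * ennreal (G x) \<partial>avg) = ennreal 2 * (\<integral>\<^sup>+x. ennreal (G x) \<partial>avg)"
      by (rule nn_integral_cmult) simp
    ultimately show ?thesis by (subst nn_integral_add) simp_all
  qed
  also have "\<dots> \<le> ennreal 2 * ennreal ((1 + B) * exp (L * mean_recip)) + ennreal 2"
    by (intro add_right_mono mult_left_mono GG) simp
  also have "\<dots> = ennreal (2 * ((1 + B) * exp (L * mean_recip)) + 2)"
    using B_ge_1 by (simp add: ennreal_mult[symmetric] ennreal_plus[symmetric] del: ennreal_plus ennreal_numeral)
  also have "\<dots> \<le> ennreal (2 * (2 + B) * exp (L * mean_recip))"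
    using L_nonneg mean_recip_bounds by (intro ennreal_leI) (simp add: distrib_right)
  also have "2 * (2 + B) * exp (L * mean_recip) = exp (L * mean_recip + ln (2 * (2 + B)))"
    using B_ge_1 by (simp only: exp_add) simp
  finally show ?thesis .
qed

lemma epower_average_le:
  fixes \<delta> :: real
  assumes crit: "critical_exponent avg p a b L B"
    and \<delta>: "0 \<le> \<delta>" "\<delta> * (b * (b - 1)) \<le> 1" "\<delta> * b \<le> a - 1"
    and f: "sum_norm (\<lambda>x. ereal (p x)) f \<le> 1"
  defines "C \<equiv> 1 + 2 * (exp (ln (2 * (2 + B)) * (b * (a / (a - 1)))) * B)"
  shows "(\<integral>\<^sup>+x\<in>Q. epower ((\<integral>\<^sup>+y\<in>Q. ennreal \<bar>f y\<bar> \<partial>lebesgue) / emeasure lebesgue Q) (ereal (p x)) \<partial>lebesgue)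
      / emeasure lebesgue Q
    \<le> ennreal (2 * (2 * C powr (a / (a - 1))) powr (b - 1))
        * ((\<integral>\<^sup>+x\<in>Q. epower (ennreal \<bar>f x\<bar>) (ereal (p x)) \<partial>lebesgue) / emeasure lebesgue Q)
      + ennreal (measure lebesgue Q powr \<delta>)"
proof -
  interpret critical_exponent avg p a b L B by (rule crit)
  define F where "F x = indicator Q x * \<bar>f x\<bar>" for x
  have F [measurable]: "F \<in> borel_measurable lebesgue"
    unfolding F_def by (rule sum_norm_decompose[OF f])
  have F0: "0 \<le> F x" for x by (simp add: F_def)
  define m where "m = enn2real (\<integral>\<^sup>+x. ennreal (F x) \<partial>avg)"
  note le = average_le[OF crit f, folded F_def]
  have m: "(\<integral>\<^sup>+x. ennreal (F x) \<partial>avg) = ennreal m"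
    unfolding m_def using le by (intro ennreal_enn2real[symmetric]) (auto simp: less_top[symmetric] top_unique)
  have m0: "0 \<le> m" by (simp add: m_def)
  have m_le: "m \<le> exp (L * mean_recip + ln (2 * (2 + B)))"
    using le unfolding m by simp
  have avg_f: "(\<integral>\<^sup>+y\<in>Q. ennreal \<bar>f y\<bar> \<partial>lebesgue) / emeasure lebesgue Q = ennreal m"
  proof -
    have "(\<integral>\<^sup>+y\<in>Q. ennreal \<bar>f y\<bar> \<partial>lebesgue) = (\<integral>\<^sup>+y\<in>Q. ennreal (F y) \<partial>lebesgue)"
      by (intro nn_integral_cong) (auto simp: F_def split: split_indicator)
    then show ?thesis by (simp add: m[symmetric] nn_integral_avg)
  qed
  have lhs: "(\<integral>\<^sup>+x\<in>Q. epower (ennreal m) (ereal (p x)) \<partial>lebesgue) / emeasure lebesgue Q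
      = (\<integral>\<^sup>+x. ennreal (m powr p x) \<partial>avg)"
    using m0 by (subst nn_integral_avg) (auto simp: epower_ereal)
  have rhs: "(\<integral>\<^sup>+x\<in>Q. epower (ennreal \<bar>f x\<bar>) (ereal (p x)) \<partial>lebesgue) / emeasure lebesgue Q
      = (\<integral>\<^sup>+x. ennreal (F x powr p x) \<partial>avg)"
  proof -
    have "(\<integral>\<^sup>+x\<in>Q. epower (ennreal \<bar>f x\<bar>) (ereal (p x)) \<partial>lebesgue) = (\<integral>\<^sup>+x\<in>Q. ennreal (F x powr p x) \<partial>lebesgue)"
      by (intro nn_integral_cong) (auto simp: F_def epower_ereal split: split_indicator)
    then show ?thesis by (simp add: nn_integral_avg)
  qed
  have err: "measure lebesgue Q powr \<delta> = exp (- (\<delta> * L))"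
    by (simp add: measure_Q powr_def)
  have d: "0 \<le> ln (2 * (2 + B))" using B_ge_1 by simp
  show ?thesis
    unfolding avg_f lhs rhs err C_def
    using F by (intro modular_Jensen_error[OF d \<delta> _ F0 m m0 m_le]) simp
qed

end

section \<open>The averaging estimate for small cubes\<close>

theorem theorem2p3:
  fixes p_minus p_plus :: ereal and K_A K_N :: ennreal
  assumes "1 < p_minus" and "p_minus \<le> p_plus" and "p_plus < \<infinity>"
  shows "\<exists>c \<epsilon> :: real. c > 0 \<and> \<epsilon> > 0 \<and>
    (\<forall>(p :: real ^ 'n \<Rightarrow> ereal) p_inf.
       exponent_bounds p_minus p_plus p \<longrightarrow>
       p \<in> class_A \<inter> class_N p_minus p_plus \<longrightarrow>
       A_const p = K_A \<longrightarrow>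
       nekvinda_limit p_minus p_plus p p_inf \<longrightarrow> N_const p p_inf = K_N \<longrightarrow>
       (\<forall>Q \<in> cubes. emeasure lebesgue Q \<le> 1 \<longrightarrow>
         (\<forall>f. sum_norm p f \<le> 1 \<longrightarrow>
           (\<integral>\<^sup>+ x\<in>Q. epower ((\<integral>\<^sup>+ y\<in>Q. ennreal \<bar>f y\<bar> \<partial>lebesgue) / emeasure lebesgue Q) (p x)
              \<partial>lebesgue) / emeasure lebesgue Q
           \<le> ennreal c * ((\<integral>\<^sup>+ x\<in>Q. epower (ennreal \<bar>f x\<bar>) (p x) \<partial>lebesgue) / emeasure lebesgue Q)
             + ennreal (measure lebesgue Q powr \<epsilon>))))"
proof -
  obtain a b :: real where ab: "p_minus = ereal a" "p_plus = ereal b"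
    using assms by (cases p_minus; cases p_plus) auto
  then have a: "1 < a" "a \<le> b" using assms by (auto simp: one_ereal_def)
  \<comment> \<open>If \<open>K_A\<close> is infinite, no exponent of the class has it as its constant, so the value of \<open>K\<close>
    in that case is immaterial.\<close>
  define K where "K = max 1 (enn2real K_A)"
  define B where "B = (2 * K) powr (b + a / (a - 1))"
  define C where "C = 1 + 2 * (exp (ln (2 * (2 + B)) * (b * (a / (a - 1)))) * B)"
  define c where "c = 2 * (2 * C powr (a / (a - 1))) powr (b - 1)"
  define \<delta> where "\<delta> = min (1 / (b * (b - 1))) ((a - 1) / b)"
  have \<delta>: "0 < \<delta>" "\<delta> * (b * (b - 1)) \<le> 1" "\<delta> * b \<le> a - 1"
    using a by (auto simp: \<delta>_def min_def field_simps)
  have "0 \<le> B" by (simp add: B_def)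
  then have "1 \<le> C" by (simp add: C_def)
  then have c: "0 < c" by (simp add: c_def)
  show ?thesis
  proof (rule exI[of _ c], rule exI[of _ \<delta>], intro conjI c \<delta>(1) allI impI ballI)
    fix p :: "real ^ 'n \<Rightarrow> ereal" and p_inf :: ereal and Q :: "(real ^ 'n) set" and f :: "real ^ 'n \<Rightarrow> real"
    assume bounds: "exponent_bounds p_minus p_plus p"
      and cls: "p \<in> class_A \<inter> class_N p_minus p_plus" and A: "A_const p = K_A"
      and Q: "Q \<in> cubes" "emeasure lebesgue Q \<le> 1" and f: "sum_norm p f \<le> 1"
    define P where "P x = real_of_ereal (p x)" for x
    have pb: "ereal a \<le> p x" "p x \<le> ereal b" for x
      using bounds by (auto simp: exponent_bounds_def ab)
    have p: "p = (\<lambda>x. ereal (P x))"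
    proof
      show "p x = ereal (P x)" for x
        using pb[of x] by (cases "p x") (auto simp: P_def)
    qed
    have [measurable]: "p \<in> borel_measurable lebesgue"
      using cls by (simp add: class_A_def variable_exponent_def)
    have "P \<in> borel_measurable lebesgue" unfolding P_def by measurable
    then interpret cube_exponent Q P a b
      using Q a pb by unfold_locales (auto simp: p)
    have "K_A < \<infinity>" using cls A by (auto simp: class_A_def)
    then have "K_A = ennreal (enn2real K_A)" by simp
    also have "\<dots> \<le> ennreal K" by (intro ennreal_leI) (simp add: K_def)
    finally have "A_const (\<lambda>x. ereal (P x)) \<le> ennreal K" using A p by simp
    then have "critical_exponent avg P a b L B"
      unfolding B_def by (intro critical_exponent_of_A) (simp_all add: K_def)
    from epower_average_le[OF this less_imp_le[OF \<delta>(1)] \<delta>(2,3) f[unfolded p]]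
    show "(\<integral>\<^sup>+ x\<in>Q. epower ((\<integral>\<^sup>+ y\<in>Q. ennreal \<bar>f y\<bar> \<partial>lebesgue) / emeasure lebesgue Q) (p x)
              \<partial>lebesgue) / emeasure lebesgue Q
           \<le> ennreal c * ((\<integral>\<^sup>+ x\<in>Q. epower (ennreal \<bar>f x\<bar>) (p x) \<partial>lebesgue) / emeasure lebesgue Q)
             + ennreal (measure lebesgue Q powr \<delta>)"
      unfolding p c_def C_def .
  qed
qed

end
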